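(* Let $\boldsymbol{P}\in\mathbb{R}^{[3,n]}$. The following identities hold: $$\mathcal{T}_R(\boldsymbol{P})=\frac12\max_{j_1,j_2,k}\sum_{i=1}^n|\boldsymbol{P}_{ij_1k}-\boldsymbol{P}_{ij_2k}|,$$ $$\mathcal{T}(\boldsymbol{P})=\frac12\max_{j,k_1,k_2}\sum_i|\boldsymbol{P}_{ijk_1}-\boldsymbol{P}_{ijk_2}+\boldsymbol{P}_{ik_1j}-\boldsymbol{P}_{ik_2j}|.$$ Moreover, if $\boldsymbol{P}$ is stochastic then $$\mathcal{T}_R(\boldsymbol{P})=1-\min_{j_1,j_2,k}\sum_{i=1}^n\min\{\boldsymbol{P}_{ij_1k},\boldsymbol{P}_{ij_2k}\}=1-\min_{\mathcal{I}\subset[n]}\min_{j_1,j_2,k}\Big(\sum_{i\notin\mathcal{I}}\boldsymbol{P}_{ij_1k}+\sum_{i\in\mathcal{I}}\boldsymbol{P}_{ij_2k}\Big),$$ $$\mathcal{T}(\boldsymbol{P})=2-\min_{j,k_1,k_2}\sum_i\min\{\boldsymbol{P}_{ijk_1}+\boldsymbol{P}_{ik_1j},\ \boldsymbol{P}_{ijk_2}+\boldsymbol{P}_{ik_2j}\}$$ $$\phantom{\mathcal{T}(\boldsymbol{P})}=2-\min_{\mathcal{I}\subset[n]}\min_j\Big(\min_{k_1}\sum_{i\in\mathcal{I}}(\boldsymbol{P}_{ijk_1}+\boldsymbol{P}_{ik_1j})+\min_{k_2}\sum_{i\notin\mathcal{I}}(\boldsymbol{P}_{ijk_2}+\bolds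ymbol{P}_{ik_2j})\Big).$$
   Context: $\mathbb{R}^{[3,n]}$ is the set of real $n\times n\times n$ arrays $\boldsymbol{P}=(\boldsymbol{P}_{ijk})$ (cubical tensors of order 3), $n\ge 2$. All indices range over $[n]=\{1,\dots,n\}$; $\mathcal{I}$ ranges over the subsets of $[n]$, and empty sums are $0$. $\boldsymbol{P}$ is called stochastic if $\boldsymbol{P}_{ijk}\ge 0$ for all $i,j,k$ and $\sum_{i=1}^n\boldsymbol{P}_{ijk}=1$ for all $j,k$. For $x,y\in\mathbb{R}^n$, $(\boldsymbol{P}xy)_i=\sum_{j,k}\boldsymbol{P}_{ijk}x_jy_k$. Let $\mathcal{S}_1=\{x\in\mathbb{R}^n: x\ge 0,\ \|x\|_1=1\}$ and $\mathcal{Z}_1=\{x\in\mathbb{R}^n:\sum_i x_i=0,\ \|x\|_1=1\}$. Definitions: $\mathcal{T}_R(\boldsymbol{P})=\max_{x\in\mathcal{S}_1}\max_{y\in\mathcal{Z}_1}\|\boldsymbol{P}yx\|_1$ and $\mathcal{T}(\boldsymbol{P})=\max_{x\in\mathcal{S}_1}\max_{y\in\mathcal{Z}_1}\|\boldsymbol{P}xy+\boldsymbol{P}yx\|_1$. *)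

theory Defs
  imports "HOL-Analysis.Analysis"
begin

text \<open>
  The index set $[n]$ is rendered as a finite type \<open>'n\<close>, and the entry $P_{ijk}$ of a
  cubical tensor of order 3 is \<open>P $ i $ j $ k\<close>.
\<close>

type_synonym 'n tensor3 = "real ^ 'n ^ 'n ^ 'n"

definition stochastic :: "('n::finite) tensor3 \<Rightarrow> bool" where
  "stochastic P \<longleftrightarrow>
     (\<forall>i j k. P $ i $ j $ k \<ge> 0) \<and> (\<forall>j k. (\<Sum>i\<in>UNIV. P $ i $ j $ k) = 1)"

definition tapply :: "('n::finite) tensor3 \<Rightarrow> real ^ 'n \<Rightarrow> real ^ 'n \<Rightarrow> real ^ 'n" where
  "tapply P x y = (\<chi> i. \<Sum>j\<in>UNIV. \<Sum>k\<in>UNIV. P $ i $ j $ k * x $ j * y $ k)"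

definition norm1 :: "real ^ ('n::finite) \<Rightarrow> real" where
  "norm1 x = (\<Sum>i\<in>UNIV. \<bar>x $ i\<bar>)"

definition S1 :: "(real ^ ('n::finite)) set" where
  "S1 = {x. (\<forall>i. x $ i \<ge> 0) \<and> norm1 x = 1}"

definition Z1 :: "(real ^ ('n::finite)) set" where
  "Z1 = {x. (\<Sum>i\<in>UNIV. x $ i) = 0 \<and> norm1 x = 1}"

text \<open>
  Maximum of a real function over a possibly infinite set: the greatest element of the image.
  The value is meaningful only if the maximum is attained. (\<open>Max\<close> is for finite sets only,
  and \<open>Sup\<close> would not express attainment.)
\<close>

definition max_over :: "'a set \<Rightarrow> ('a \<Rightarrow> real) \<Rightarrow> real" where
  "max_over A f = (GREATEST m. m \<in> f ` A)"

definition T_R :: "('n::finite) tensor3 \<Rightarrow> real" where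
  "T_R P = max_over S1 (\<lambda>x. max_over Z1 (\<lambda>y. norm1 (tapply P y x)))"

definition T :: "('n::finite) tensor3 \<Rightarrow> real" where
  "T P = max_over S1 (\<lambda>x. max_over Z1 (\<lambda>y. norm1 (tapply P x y + tapply P y x)))"

end

(*
  For fixed x, a vector y with coordinate sum 0 and 1-norm 1 has positive and negative parts of
  mass 1/2 each.  Coupling these two parts by the product measure shows that P x y is half of an
  average of differences of columns, and y = (e_k - e_l) / 2 gives such a difference exactly.
  The remaining dependence on x is convex, so it is maximised at a vertex of the simplex.
  In the stochastic case the two columns have equal mass s, and half the 1-norm of their
  difference is s minus the sum of the entrywise minima.
*)

theory Submission
  imports Defs
begin

section \<open>Maxima over arbitrary sets and minima over finite types\<close>

lemma max_over_eqI:
  assumes "\<And>x. x \<in> A \<Longrightarrow> f x \<le> m" and "a \<in> A" and "f a = m"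
  shows "max_over A f = m"
  unfolding max_over_def by (rule Greatest_equality) (use assms in auto)

text \<open>Mutual domination lets minima over two different index types be compared without any
  bijection between them.\<close>

lemma Min_range_eqI:
  fixes f :: "'a::finite \<Rightarrow> real" and g :: "'b::finite \<Rightarrow> real"
  assumes "\<And>a. \<exists>b. g b \<le> f a" and "\<And>b. \<exists>a. f a \<le> g b"
  shows "Min (range f) = Min (range g)"
proof (rule antisym)
  show "Min (range f) \<le> Min (range g)"
    using assms(2) by (subst Min_ge_iff) (auto simp: Min_le_iff)
  show "Min (range g) \<le> Min (range f)"
    using assms(1) by (subst Min_ge_iff) (auto simp: Min_le_iff)
qed

lemma Min_range_attained:
  fixes f :: "'a::finite \<Rightarrow> real"
  obtains a where "Min (range f) = f a"
proof -
  have "Min (range f) \<in> range f"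
    by (rule Min_in) auto
  then show ?thesis
    by (rule rangeE) (rule that)
qed

lemma Min_range_le:
  fixes f :: "'a::finite \<Rightarrow> real"
  shows "Min (range f) \<le> f a"
  by simp

lemma MAX_diff_eq_diff_MIN:
  fixes f :: "'a::finite \<Rightarrow> real"
  shows "(MAX x. c - f x) = c - (MIN x. f x)"
proof (rule Max_eqI)
  show "y \<le> c - (MIN x. f x)" if "y \<in> range (\<lambda>x. c - f x)" for y
    using that by (auto simp: Min_range_le)
  show "c - (MIN x. f x) \<in> range (\<lambda>x. c - f x)"
    by (rule Min_range_attained[of f]) auto
qed simp

section \<open>The 1-norm and nonnegative combinations\<close>

lemma norm1_ge_0: "norm1 x \<ge> 0"
  by (simp add: norm1_def sum_nonneg)

lemma norm1_scaleR: "norm1 (a *\<^sub>R x) = \<bar>a\<bar> * norm1 x"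
  by (simp add: norm1_def abs_mult sum_distrib_left)

lemma norm1_triangle: "norm1 (x + y) \<le> norm1 x + norm1 y"
  unfolding norm1_def sum.distrib[symmetric] by (rule sum_mono) simp

lemma norm1_sum_le: "norm1 (\<Sum>a\<in>A. f a) \<le> (\<Sum>a\<in>A. norm1 (f a))"
proof (induction A rule: infinite_finite_induct)
  case (insert a A)
  then show ?case
    using norm1_triangle[of "f a" "sum f A"] by simp
qed (simp_all add: norm1_def)

text \<open>The weights may have any total mass: it is 1 for a point of the simplex and 1/4 for the
  product of two parts of mass 1/2.\<close>

lemma norm1_sum_le_convex:
  fixes w :: "'a \<Rightarrow> real"
  assumes "\<And>a. a \<in> A \<Longrightarrow> w a \<ge> 0" and "\<And>a. a \<in> A \<Longrightarrow> norm1 (f a) \<le> D"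
  shows "norm1 (\<Sum>a\<in>A. w a *\<^sub>R f a) \<le> (\<Sum>a\<in>A. w a) * D"
proof -
  have "norm1 (\<Sum>a\<in>A. w a *\<^sub>R f a) \<le> (\<Sum>a\<in>A. norm1 (w a *\<^sub>R f a))"
    by (rule norm1_sum_le)
  also have "\<dots> \<le> (\<Sum>a\<in>A. w a * D)"
    by (rule sum_mono) (use assms in \<open>simp add: norm1_scaleR mult_left_mono\<close>)
  finally show ?thesis
    by (simp add: sum_distrib_right)
qed

section \<open>Maximisation over \<open>Z1\<close> and \<open>S1\<close>\<close>

lemma norm1_zero_sum_combination_le:
  fixes c :: "'n::finite \<Rightarrow> real ^ 'm::finite"
  assumes y: "y \<in> Z1" and D: "\<And>k l. norm1 (c k - c l) \<le> D"
  shows "norm1 (\<Sum>k\<in>UNIV. y $ k *\<^sub>R c k) \<le> 1 / 2 * D"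
proof -
  define p where "p k = max 0 (y $ k)" for k
  define q where "q k = max 0 (- y $ k)" for k
  have pq: "y $ k = p k - q k" "\<bar>y $ k\<bar> = p k + q k" for k
    by (auto simp: p_def q_def)
  have "sum p UNIV - sum q UNIV = 0" "sum p UNIV + sum q UNIV = 1"
    using y unfolding sum_subtractf[symmetric] sum.distrib[symmetric]
    by (simp_all add: Z1_def norm1_def flip: pq)
  then have half: "sum p UNIV = 1 / 2" "sum q UNIV = 1 / 2"
    by linarith+
  \<comment> \<open>The weights \<open>p k * q l\<close> have marginals \<open>p k / 2\<close> and
    \<open>q l / 2\<close>, so this double sum is only half of the combination to be
    bounded.\<close>
  have "(\<Sum>(k, l)\<in>UNIV. (p k * q l) *\<^sub>R (c k - c l))
      = (\<Sum>k\<in>UNIV. \<Sum>l\<in>UNIV. (p k * q l) *\<^sub>R (c k - c l))"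
    by (simp add: sum.cartesian_product flip: UNIV_Times_UNIV)
  also have "\<dots> = (\<Sum>k\<in>UNIV. \<Sum>l\<in>UNIV. (p k * q l) *\<^sub>R c k)
      - (\<Sum>k\<in>UNIV. \<Sum>l\<in>UNIV. (p k * q l) *\<^sub>R c l)"
    by (simp add: scaleR_diff_right sum_subtractf)
  also have "(\<Sum>k\<in>UNIV. \<Sum>l\<in>UNIV. (p k * q l) *\<^sub>R c k) = (\<Sum>k\<in>UNIV. (p k * sum q UNIV) *\<^sub>R c k)"
    by (simp add: sum_distrib_left flip: scaleR_sum_left)
  also have "(\<Sum>k\<in>UNIV. \<Sum>l\<in>UNIV. (p k * q l) *\<^sub>R c l) = (\<Sum>l\<in>UNIV. (sum p UNIV * q l) *\<^sub>R c l)"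
    by (subst sum.swap) (simp add: sum_distrib_right flip: scaleR_sum_left)
  also have "(\<Sum>k\<in>UNIV. (p k * sum q UNIV) *\<^sub>R c k) - (\<Sum>l\<in>UNIV. (sum p UNIV * q l) *\<^sub>R c l)
      = (1 / 2) *\<^sub>R (\<Sum>k\<in>UNIV. y $ k *\<^sub>R c k)"
    by (simp add: half pq scaleR_sum_right scaleR_diff_left scaleR_diff_right sum_subtractf
        mult.commute)
  finally have "norm1 (\<Sum>k\<in>UNIV. y $ k *\<^sub>R c k)
      = 2 * norm1 (\<Sum>(k, l)\<in>UNIV. (p k * q l) *\<^sub>R (c k - c l))"
    by (simp add: norm1_scaleR)
  \<comment> \<open>The total weight is 1/4; with the factor 2 from above it yields the constant
    1/2.\<close>
  also have "norm1 (\<Sum>(k, l)\<in>UNIV. (p k * q l) *\<^sub>R (c k - c l)) \<le> (\<Sum>(k, l)\<in>UNIV. p k * q l) * D"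
    using norm1_sum_le_convex[of UNIV "\<lambda>(k, l). p k * q l" "\<lambda>(k, l). c k - c l" D] D
    by (simp add: case_prod_unfold p_def q_def)
  also have "(\<Sum>(k, l)\<in>UNIV. p k * q l) = sum p UNIV * sum q UNIV"
    by (simp add: sum_product sum.cartesian_product flip: UNIV_Times_UNIV)
  finally show ?thesis
    by (simp add: half)
qed

text \<open>The upper bound is \<open>norm1_zero_sum_combination_le\<close>; it is attained at half
  the difference of two basis vectors. The cardinality hypothesis supplies two distinct indices,
  without which \<open>Z1\<close> would be empty.\<close>

lemma max_over_Z1_norm1:
  fixes c :: "'n::finite \<Rightarrow> real ^ 'm::finite"
  assumes "CARD('n) \<ge> 2"
  shows "max_over Z1 (\<lambda>y. norm1 (\<Sum>k\<in>UNIV. y $ k *\<^sub>R c k)) = 1 / 2 * (MAX (k, l). norm1 (c k - c l))"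
    (is "_ = 1 / 2 * ?D")
proof -
  have le: "norm1 (c k - c l) \<le> ?D" for k l
    by (rule Max_ge) (auto intro!: image_eqI[where x = "(k, l)"])
  have "?D \<in> range (\<lambda>(k, l). norm1 (c k - c l))"
    by (rule Max_in) auto
  then obtain k l where kl: "?D = norm1 (c k - c l)"
    by (metis (mono_tags, lifting) case_prod_unfold rangeE)
  \<comment> \<open>A maximising pair may lie on the diagonal, where the intended witness is zero
    and so not in \<open>Z1\<close>. In that case the maximum is 0, and any two distinct indices
    attain it.\<close>
  obtain k' l' where ne: "k' \<noteq> l'" and kl': "?D = norm1 (c k' - c l')"
  proof (cases "k = l")
    case True
    obtain a b :: 'n where "a \<noteq> b"
      using assms by (metis (full_types) UNIV_I card_2_iff' card_le_Suc0_iff_eq finite not_less_eq_eq numeral_2_eq_2)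
    moreover have "?D = norm1 (c a - c b)"
    proof (rule antisym)
      have "?D = 0"
        using kl True by (simp add: norm1_def)
      then show "?D \<le> norm1 (c a - c b)"
        using norm1_ge_0[of "c a - c b"] by linarith
    qed (rule le)
    ultimately show ?thesis
      by (rule that)
  next
    case False
    then show ?thesis
      using kl by (rule that)
  qed
  define y :: "real ^ 'n" where "y = (1 / 2) *\<^sub>R (axis k' 1 - axis l' 1)"
  have y_nth: "y $ i = (if i = k' then 1 / 2 else 0) - (if i = l' then 1 / 2 else 0)" for i
    by (simp add: y_def axis_def)
  have y_abs: "\<bar>y $ i\<bar> = (if i = k' then 1 / 2 else 0) + (if i = l' then 1 / 2 else 0)" for i
    using ne by (simp add: y_nth)
  show ?thesis
  proof (rule max_over_eqI)
    show "y \<in> Z1"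
      unfolding Z1_def norm1_def mem_Collect_eq y_abs
      by (simp add: y_nth sum.distrib sum_subtractf)
    have "(\<Sum>k\<in>UNIV. y $ k *\<^sub>R c k)
        = (\<Sum>k\<in>UNIV. (if k = k' then (1 / 2) *\<^sub>R c k else 0) - (if k = l' then (1 / 2) *\<^sub>R c k else 0))"
      by (rule sum.cong) (auto simp: y_nth)
    also have "\<dots> = (1 / 2) *\<^sub>R (c k' - c l')"
      by (simp add: sum_subtractf scaleR_diff_right)
    finally show "norm1 (\<Sum>k\<in>UNIV. y $ k *\<^sub>R c k) = 1 / 2 * ?D"
      by (simp add: kl' norm1_scaleR)
  qed (use norm1_zero_sum_combination_le le in blast)
qed

text \<open>For each \<open>a\<close> the norm is convex in \<open>x\<close>, and the vertex
  \<open>axis j 1\<close> turns the combination into \<open>B j a\<close>. The factor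
  \<open>r\<close> makes room for the 1/2 left by the inner maximum over \<open>Z1\<close>.\<close>

lemma max_over_S1_norm1:
  fixes B :: "'n::finite \<Rightarrow> 'a::finite \<Rightarrow> real ^ 'm::finite"
  assumes "r \<ge> 0"
  shows "max_over S1 (\<lambda>x. r * (MAX a. norm1 (\<Sum>j\<in>UNIV. x $ j *\<^sub>R B j a)))
    = r * (MAX (j, a). norm1 (B j a))"
    (is "_ = r * ?D")
proof -
  have le: "norm1 (B j a) \<le> ?D" for j a
    by (rule Max_ge) (auto intro!: image_eqI[where x = "(j, a)"])
  have upper: "(MAX a. norm1 (\<Sum>j\<in>UNIV. x $ j *\<^sub>R B j a)) \<le> ?D" if x: "x \<in> S1" for x
  proof (rule Max.boundedI)
    fix v assume "v \<in> range (\<lambda>a. norm1 (\<Sum>j\<in>UNIV. x $ j *\<^sub>R B j a))"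
    then obtain a where v: "v = norm1 (\<Sum>j\<in>UNIV. x $ j *\<^sub>R B j a)"
      by auto
    have "v \<le> (\<Sum>j\<in>UNIV. x $ j) * ?D"
      unfolding v by (rule norm1_sum_le_convex) (use x le in \<open>auto simp: S1_def\<close>)
    moreover have "(\<Sum>j\<in>UNIV. x $ j) = 1"
      using x by (auto simp: S1_def norm1_def)
    ultimately show "v \<le> ?D"
      by simp
  qed auto
  have "?D \<in> range (\<lambda>(j, a). norm1 (B j a))"
    by (rule Max_in) auto
  then obtain j a where ja: "?D = norm1 (B j a)"
    by (metis (mono_tags, lifting) case_prod_unfold rangeE)
  have ax: "axis j 1 \<in> S1"
    by (simp add: S1_def norm1_def axis_def if_distrib[of abs] cong: if_cong)
  have "(\<Sum>i\<in>UNIV. axis j 1 $ i *\<^sub>R B i b) = (\<Sum>i\<in>UNIV. if i = j then B i b else 0)" for b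
    by (rule sum.cong) (auto simp: axis_def)
  then have eval: "(\<Sum>i\<in>UNIV. axis j 1 $ i *\<^sub>R B i b) = B j b" for b
    by simp
  \<comment> \<open>The vertex reaches the bound through the single index \<open>a\<close>;
    \<open>upper\<close> caps all other \<open>b\<close>.\<close>
  have "?D \<le> (MAX b. norm1 (\<Sum>i\<in>UNIV. axis j 1 $ i *\<^sub>R B i b))"
    unfolding ja eval by simp
  with upper[OF ax] have "(MAX b. norm1 (\<Sum>i\<in>UNIV. axis j 1 $ i *\<^sub>R B i b)) = ?D"
    by (rule antisym)
  with ax upper assms show ?thesis
    by (intro max_over_eqI[where a = "axis j 1"]) (auto intro: mult_left_mono)
qed

text \<open>Common form of both coefficients: a bilinear map given by its values
  \<open>B j k\<close> on pairs of basis vectors. Differences of the inner combinations are again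
  combinations over \<open>j\<close>, so the result of the inner maximum has the shape required for
  the outer one.\<close>

lemma max_over_bilinear_norm1:
  fixes B :: "'n::finite \<Rightarrow> 'k::finite \<Rightarrow> real ^ 'm::finite"
  assumes "CARD('k) \<ge> 2"
  shows "max_over S1 (\<lambda>x. max_over Z1 (\<lambda>y.
      norm1 (\<Sum>k\<in>UNIV. y $ k *\<^sub>R (\<Sum>j\<in>UNIV. x $ j *\<^sub>R B j k))))
    = 1 / 2 * (MAX (j, k, l). norm1 (B j k - B j l))"
proof -
  have diff: "(\<Sum>j\<in>UNIV. x $ j *\<^sub>R B j k) - (\<Sum>j\<in>UNIV. x $ j *\<^sub>R B j l)
      = (\<Sum>j\<in>UNIV. x $ j *\<^sub>R (B j k - B j l))" for x :: "real ^ 'n" and k l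
    by (simp add: scaleR_diff_right sum_subtractf)
  show ?thesis
    unfolding max_over_Z1_norm1[OF assms] diff
    using max_over_S1_norm1[of "1 / 2" "\<lambda>j (k, l). B j k - B j l"]
    by (simp add: case_prod_unfold)
qed

section \<open>Maximum formulas for the two coefficients\<close>

lemma T_R_eq_MAX:
  fixes P :: "('n::finite) tensor3"
  assumes "CARD('n) \<ge> 2"
  shows "T_R P = 1 / 2 * (MAX (j1, j2, k). (\<Sum>i\<in>UNIV. \<bar>P $ i $ j1 $ k - P $ i $ j2 $ k\<bar>))"
proof -
  \<comment> \<open>The zero-sum vector \<open>y\<close> occupies the first slot, hence the
    transposed indices \<open>P $ i $ k $ j\<close>.\<close>
  have "tapply P y x = (\<Sum>k\<in>UNIV. y $ k *\<^sub>R (\<Sum>j\<in>UNIV. x $ j *\<^sub>R (\<chi> i. P $ i $ k $ j)))" for x y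
    by (simp add: tapply_def vec_eq_iff sum_distrib_left mult_ac)
  then have "T_R P = 1 / 2 * (MAX (k, j1, j2). (\<Sum>i\<in>UNIV. \<bar>P $ i $ j1 $ k - P $ i $ j2 $ k\<bar>))"
    unfolding T_R_def using max_over_bilinear_norm1[OF assms, of "\<lambda>j k. \<chi> i. P $ i $ k $ j"]
    by (simp add: norm1_def)
  \<comment> \<open>The bilinear formula lists the fixed index first, the stated one lists it last;
    the set of values is the same.\<close>
  also have "range (\<lambda>(k, j1, j2). \<Sum>i\<in>UNIV. \<bar>P $ i $ j1 $ k - P $ i $ j2 $ k\<bar>)
      = range (\<lambda>(j1, j2, k). \<Sum>i\<in>UNIV. \<bar>P $ i $ j1 $ k - P $ i $ j2 $ k\<bar>)"
    by (force simp: image_def)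
  finally show ?thesis .
qed

text \<open>The two orders of the arguments add up to one bilinear map, whose coefficients are the
  symmetrised entries \<open>P $ i $ j $ k + P $ i $ k $ j\<close>.\<close>

lemma T_eq_MAX:
  fixes P :: "('n::finite) tensor3"
  assumes "CARD('n) \<ge> 2"
  shows "T P = 1 / 2 * (MAX (j, k1, k2).
        (\<Sum>i\<in>UNIV. \<bar>P $ i $ j $ k1 - P $ i $ j $ k2 + P $ i $ k1 $ j - P $ i $ k2 $ j\<bar>))"
proof -
  have "tapply P x y + tapply P y x
      = (\<Sum>k\<in>UNIV. y $ k *\<^sub>R (\<Sum>j\<in>UNIV. x $ j *\<^sub>R (\<chi> i. P $ i $ j $ k + P $ i $ k $ j)))" for x y
  proof -
    \<comment> \<open>Here \<open>y\<close> is the second argument, so the sums are swapped to make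
      its index the outer one.\<close>
    have "tapply P x y $ i = (\<Sum>k\<in>UNIV. \<Sum>j\<in>UNIV. P $ i $ j $ k * x $ j * y $ k)" for i
      unfolding tapply_def by (simp, rule sum.swap)
    then show ?thesis
      by (simp add: vec_eq_iff, simp add: tapply_def sum_distrib_left sum.distrib algebra_simps)
  qed
  then have "T P = 1 / 2 * (MAX (j, k1, k2). (\<Sum>i\<in>UNIV.
      \<bar>P $ i $ j $ k1 + P $ i $ k1 $ j - (P $ i $ j $ k2 + P $ i $ k2 $ j)\<bar>))"
    unfolding T_def
    using max_over_bilinear_norm1[OF assms, of "\<lambda>j k. \<chi> i. P $ i $ j $ k + P $ i $ k $ j"]
    by (simp add: norm1_def)
  moreover have "P $ i $ j $ k1 + P $ i $ k1 $ j - (P $ i $ j $ k2 + P $ i $ k2 $ j)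
      = P $ i $ j $ k1 - P $ i $ j $ k2 + P $ i $ k1 $ j - P $ i $ k2 $ j" for i j k1 k2
    by simp
  ultimately show ?thesis
    by (simp only:)
qed

section \<open>Entrywise minima and splittings of the index set\<close>

lemma half_sum_abs_diff_eq:
  fixes a b :: "'a \<Rightarrow> real"
  assumes "sum a A = s" and "sum b A = s"
  shows "1 / 2 * (\<Sum>i\<in>A. \<bar>a i - b i\<bar>) = s - (\<Sum>i\<in>A. min (a i) (b i))"
proof -
  have "\<bar>a i - b i\<bar> = a i + b i - 2 * min (a i) (b i)" for i
    by (simp add: min_def)
  then show ?thesis
    using assms by (simp add: sum.distrib sum_subtractf flip: sum_distrib_left)
qed

text \<open>The index \<open>p\<close> stands for a triple of tensor indices, and the common mass
  \<open>s\<close> is 1 for \<open>T_R\<close> and 2 for \<open>T\<close>.\<close>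

lemma half_MAX_sum_abs_diff_eq:
  fixes a b :: "'p::finite \<Rightarrow> 'a \<Rightarrow> real"
  assumes "\<And>p. sum (a p) A = s" and "\<And>p. sum (b p) A = s"
  shows "1 / 2 * (MAX p. \<Sum>i\<in>A. \<bar>a p i - b p i\<bar>) = s - (MIN p. \<Sum>i\<in>A. min (a p i) (b p i))"
proof -
  have "1 / 2 * (MAX p. \<Sum>i\<in>A. \<bar>a p i - b p i\<bar>) = (MAX p. 1 / 2 * (\<Sum>i\<in>A. \<bar>a p i - b p i\<bar>))"
    by (subst mono_Max_commute[where f = "\<lambda>x. 1 / 2 * x"]) (auto simp: mono_def image_image)
  then show ?thesis
    unfolding half_sum_abs_diff_eq[OF assms] MAX_diff_eq_diff_MIN .
qed

lemma sum_min_le_split: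
  fixes a b :: "'a::finite \<Rightarrow> real"
  shows "(\<Sum>i\<in>UNIV. min (a i) (b i)) \<le> sum a I + sum b (- I)"
proof -
  have "(\<Sum>i\<in>UNIV. min (a i) (b i)) = (\<Sum>i\<in>I. min (a i) (b i)) + (\<Sum>i\<in>- I. min (a i) (b i))"
    by (subst sum.union_disjoint[symmetric]) auto
  also have "\<dots> \<le> sum a I + sum b (- I)"
    by (intro add_mono sum_mono) auto
  finally show ?thesis .
qed

text \<open>The set where \<open>a\<close> is the smaller entry selects the minimum in every
  coordinate, so the bound in \<open>sum_min_le_split\<close> is attained.\<close>

lemma sum_min_eq_split:
  fixes a b :: "'a::finite \<Rightarrow> real"
  defines "I \<equiv> {i. a i \<le> b i}"
  shows "sum a I + sum b (- I) = (\<Sum>i\<in>UNIV. min (a i) (b i))"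
proof -
  have "(\<Sum>i\<in>UNIV. min (a i) (b i)) = (\<Sum>i\<in>I. min (a i) (b i)) + (\<Sum>i\<in>- I. min (a i) (b i))"
    by (subst sum.union_disjoint[symmetric]) auto
  also have "\<dots> = sum a I + sum b (- I)"
    by (intro arg_cong2[where f = "(+)"] sum.cong) (auto simp: I_def min_def)
  finally show ?thesis ..
qed

text \<open>For fixed \<open>p\<close> the sum of minima is the least value over all splittings of
  the index set; the minima over \<open>p\<close> and over \<open>I\<close> may then be
  exchanged.\<close>

lemma MIN_sum_min_eq_MIN_split:
  fixes a b :: "'p::finite \<Rightarrow> 'a::finite \<Rightarrow> real"
  shows "(MIN p. \<Sum>i\<in>UNIV. min (a p i) (b p i)) = (MIN I. MIN p. sum (a p) (- I) + sum (b p) I)"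
proof (rule Min_range_eqI)
  fix p
  \<comment> \<open>A complement, because in this statement \<open>a\<close> is summed over
    \<open>- I\<close>.\<close>
  define I where "I = - {i. a p i \<le> b p i}"
  have "(MIN p. sum (a p) (- I) + sum (b p) I) \<le> sum (a p) (- I) + sum (b p) I"
    by (rule Min_range_le)
  also have "\<dots> = (\<Sum>i\<in>UNIV. min (a p i) (b p i))"
    using sum_min_eq_split[of "a p" "b p"] by (simp add: I_def)
  finally show "\<exists>I. (MIN p. sum (a p) (- I) + sum (b p) I) \<le> (\<Sum>i\<in>UNIV. min (a p i) (b p i))" ..
next
  fix I
  obtain p where "(MIN p. sum (a p) (- I) + sum (b p) I) = sum (a p) (- I) + sum (b p) I"
    by (rule Min_range_attained)
  then show "\<exists>p. (\<Sum>i\<in>UNIV. min (a p i) (b p i)) \<le> (MIN p. sum (a p) (- I) + sum (b p) I)"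
    using sum_min_le_split[of "a p" "b p" "- I"] by auto
qed

text \<open>Serves the last formula for \<open>T\<close>, where \<open>k1\<close> and
  \<open>k2\<close> vary independently once \<open>I\<close> and \<open>j\<close> are fixed.\<close>

lemma MIN_add_MIN:
  fixes f :: "'a::finite \<Rightarrow> real" and g :: "'b::finite \<Rightarrow> real"
  shows "(MIN x. f x) + (MIN y. g y) = (MIN (x, y). f x + g y)"
proof (rule Min_eqI[symmetric])
  show "(MIN x. f x) + (MIN y. g y) \<le> z" if "z \<in> range (\<lambda>(x, y). f x + g y)" for z
    using that by (auto intro!: add_mono Min_range_le)
  obtain x y where "(MIN x. f x) = f x" "(MIN y. g y) = g y"
    by (metis Min_range_attained)
  then show "(MIN x. f x) + (MIN y. g y) \<in> range (\<lambda>(x, y). f x + g y)"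
    by (auto intro!: image_eqI[where x = "(x, y)"])
qed simp

lemma MIN_MIN_eq_MIN_pair:
  fixes f :: "'a::finite \<Rightarrow> 'b::finite \<Rightarrow> real"
  shows "(MIN x. MIN y. f x y) = (MIN (x, y). f x y)"
proof (rule Min_range_eqI)
  fix x
  obtain y where "(MIN y. f x y) = f x y"
    by (rule Min_range_attained)
  then show "\<exists>q. (case q of (x, y) \<Rightarrow> f x y) \<le> (MIN y. f x y)"
    by (intro exI[where x = "(x, y)"]) simp
next
  fix q :: "'a \<times> 'b"
  show "\<exists>x. (MIN y. f x y) \<le> (case q of (x, y) \<Rightarrow> f x y)"
    by (cases q) (auto intro: Min_range_le)
qed

theorem corollary5p2:
  fixes P :: "('n::finite) tensor3"
  assumes "CARD('n) \<ge> 2"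
  shows "T_R P = 1 / 2 * (MAX (j1, j2, k). (\<Sum>i\<in>UNIV. \<bar>P $ i $ j1 $ k - P $ i $ j2 $ k\<bar>))
    \<and> T P = 1 / 2 * (MAX (j, k1, k2).
        (\<Sum>i\<in>UNIV. \<bar>P $ i $ j $ k1 - P $ i $ j $ k2 + P $ i $ k1 $ j - P $ i $ k2 $ j\<bar>))
    \<and> (stochastic P \<longrightarrow>
        T_R P = 1 - (MIN (j1, j2, k). (\<Sum>i\<in>UNIV. min (P $ i $ j1 $ k) (P $ i $ j2 $ k)))
        \<and> T_R P = 1 - (MIN I. MIN (j1, j2, k).
            (\<Sum>i\<in>-I. P $ i $ j1 $ k) + (\<Sum>i\<in>I. P $ i $ j2 $ k))
        \<and> T P = 2 - (MIN (j, k1, k2). (\<Sum>i\<in>UNIV.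
            min (P $ i $ j $ k1 + P $ i $ k1 $ j) (P $ i $ j $ k2 + P $ i $ k2 $ j)))
        \<and> T P = 2 - (MIN I. MIN j.
            (MIN k1. (\<Sum>i\<in>I. (P $ i $ j $ k1 + P $ i $ k1 $ j)))
            + (MIN k2. (\<Sum>i\<in>-I. (P $ i $ j $ k2 + P $ i $ k2 $ j)))))"
proof (intro conjI impI)
  show "T_R P = 1 / 2 * (MAX (j1, j2, k). (\<Sum>i\<in>UNIV. \<bar>P $ i $ j1 $ k - P $ i $ j2 $ k\<bar>))"
    by (rule T_R_eq_MAX[OF assms])
  show "T P = 1 / 2 * (MAX (j, k1, k2).
        (\<Sum>i\<in>UNIV. \<bar>P $ i $ j $ k1 - P $ i $ j $ k2 + P $ i $ k1 $ j - P $ i $ k2 $ j\<bar>))"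
    by (rule T_eq_MAX[OF assms])
  assume "stochastic P"
  then have P1: "(\<Sum>i\<in>UNIV. P $ i $ j $ k) = 1" for j k
    by (simp add: stochastic_def)
  show T_R: "T_R P = 1 - (MIN (j1, j2, k). (\<Sum>i\<in>UNIV. min (P $ i $ j1 $ k) (P $ i $ j2 $ k)))"
    using half_MAX_sum_abs_diff_eq[of "\<lambda>(j1, j2, k) i. P $ i $ j1 $ k" UNIV 1
        "\<lambda>(j1, j2, k) i. P $ i $ j2 $ k"]
    by (simp add: T_R_eq_MAX[OF assms] case_prod_unfold P1)
  show "T_R P = 1 - (MIN I. MIN (j1, j2, k).
      (\<Sum>i\<in>-I. P $ i $ j1 $ k) + (\<Sum>i\<in>I. P $ i $ j2 $ k))"
    using MIN_sum_min_eq_MIN_split[of "\<lambda>(j1, j2, k) i. P $ i $ j1 $ k"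
        "\<lambda>(j1, j2, k) i. P $ i $ j2 $ k"]
    by (simp add: T_R case_prod_unfold)
  have reorder: "P $ i $ j $ k1 - P $ i $ j $ k2 + P $ i $ k1 $ j - P $ i $ k2 $ j
      = (P $ i $ j $ k1 + P $ i $ k1 $ j) - (P $ i $ j $ k2 + P $ i $ k2 $ j)" for i j k1 k2
    by simp
  show T: "T P = 2 - (MIN (j, k1, k2). (\<Sum>i\<in>UNIV.
      min (P $ i $ j $ k1 + P $ i $ k1 $ j) (P $ i $ j $ k2 + P $ i $ k2 $ j)))"
    \<comment> \<open>Each symmetrised column is a sum of two stochastic columns, hence the mass
      2.\<close>
    using half_MAX_sum_abs_diff_eq[of "\<lambda>(j, k1, k2) i. P $ i $ j $ k1 + P $ i $ k1 $ j" UNIV 2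
        "\<lambda>(j, k1, k2) i. P $ i $ j $ k2 + P $ i $ k2 $ j"]
    unfolding T_eq_MAX[OF assms] reorder by (simp add: case_prod_unfold P1 sum.distrib)
  \<comment> \<open>The roles of \<open>k1\<close> and \<open>k2\<close> are interchanged since the
    splitting lemma sums its first family over \<open>- I\<close>, while the formula for
    \<open>T\<close> has \<open>k1\<close> on \<open>I\<close>. Commutativity undoes this at the
    end.\<close>
  have "(MIN (j, k1, k2). (\<Sum>i\<in>UNIV.
        min (P $ i $ j $ k2 + P $ i $ k2 $ j) (P $ i $ j $ k1 + P $ i $ k1 $ j)))
      = (MIN I. MIN (j, k1, k2). (\<Sum>i\<in>-I. (P $ i $ j $ k2 + P $ i $ k2 $ j))
          + (\<Sum>i\<in>I. (P $ i $ j $ k1 + P $ i $ k1 $ j)))"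
    using MIN_sum_min_eq_MIN_split[of "\<lambda>(j, k1, k2) i. P $ i $ j $ k2 + P $ i $ k2 $ j"
        "\<lambda>(j, k1, k2) i. P $ i $ j $ k1 + P $ i $ k1 $ j"]
    by (simp add: case_prod_unfold)
  then show "T P = 2 - (MIN I. MIN j.
            (MIN k1. (\<Sum>i\<in>I. (P $ i $ j $ k1 + P $ i $ k1 $ j)))
            + (MIN k2. (\<Sum>i\<in>-I. (P $ i $ j $ k2 + P $ i $ k2 $ j))))"
    unfolding T MIN_add_MIN MIN_MIN_eq_MIN_pair by (simp add: min.commute add.commute)
qed

end
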